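(* Let $\mathcal{X}\in\mathbb{R}^{I_1\times\cdots\times I_N}$ be a tensor with set of observable entries $\Omega$, and let $L(\mathcal{G},\mathbf{A}^{(1)},\dots,\mathbf{A}^{(N)})$ be the regularized sparse Tucker factorization loss with regularization parameter $\lambda>0$. The P-Tucker algorithm converges, since the loss function $L$ is bounded and decreases monotonically.
   Context: Notation: $[m]=\{1,\dots,m\}$; $\mathcal{G}\in\mathbb{R}^{J_1\times\cdots\times J_N}$ is the core tensor and $\mathbf{A}^{(n)}\in\mathbb{R}^{I_n\times J_n}$ ($n=1,\dots,N$) are the factor matrices; $a^{(k)}_{ij}$ is the $(i,j)$ entry of $\mathbf{A}^{(k)}$; $\|\cdot\|$ is the Frobenius norm; $\mathbf{I}_{J_n}$ is the $J_n\times J_n$ identity matrix; $\Omega$ is regarded as a set of index tuples $(i_1,\dots,i_N)$. Loss function: $$L(\mathcal{G},\mathbf{A}^{(1)},\dots,\mathbf{A}^{(N)})=\sum_{(i_1,\dots,i_N)\in\Omega}\Bigl(\mathcal{X}_{(i_1,\dots,i_N)}-\sum_{(j_1,\dots,j_N)\in[J_1]\times\cdots\times[J_N]}\mathcal{G}_{(j_1,\dots,j_N)}\prod_{k=1}^N a^{(k)}_{i_kj_k}\Bigr)^2+\lambda\sum_{k=1}^N\|\mathbf{A}^{(k)}\|^2 .$$ P-Tucker algorithm: all factor matrices $\mathbf{A}^{(n)}$ and the core tensor $\mathcal{G}$ are initialized with random real values between 0 and 1. Then iterations are performed, during which $\mathcal{G}$ is not changed. One iteration goes through the modes $n=1,\dots,N$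 in order; for each $n$, every row $i_n=1,\dots,I_n$ of $\mathbf{A}^{(n)}$ is updated (the rows of one factor matrix being independent of each other, this can be done in parallel), keeping all the other factor matrices fixed, by $$[a^{(n)}_{i_n1},\dots,a^{(n)}_{i_nJ_n}]\leftarrow \mathbf{c}^{(n)}_{i_n:}\bigl[\mathbf{B}^{(n)}_{i_n}+\lambda\mathbf{I}_{J_n}\bigr]^{-1}.$$ Here $\Omega^{(n)}_{i_n}$ is the set of tuples in $\Omega$ with $n$th coordinate $i_n$; for $\alpha=(i_1,\dots,i_N)\in\Omega$ and $j\in[J_n]$, $\delta^{(n)}_\alpha(j)=\sum_{(j_1,\dots,j_N):\,j_n=j}\mathcal{G}_{(j_1,\dots,j_N)}\prod_{k\ne n}a^{(k)}_{i_kj_k}$; $\mathbf{B}^{(n)}_{i_n}$ is the $J_n\times J_n$ matrix with $(j,j')$ entry $\sum_{\alpha\in\Omega^{(n)}_{i_n}}\delta^{(n)}_\alpha(j)\,\delta^{(n)}_\alpha(j')$; $\mathbf{c}^{(n)}_{i_n:}$ is the row vector of length $J_n$ with $j$th entry $\sum_{\alpha\in\Omega^{(n)}_{i_n}}\mathcal{X}_\alpha\,\delta^{(n)}_\alpha(j)$. After each iteration the reconstruction error (the square root of the first sum in $L$, without the regularization term) is computed, and the iterations stop when this error converges or a maximum number of iterations is reached. After the iterations have stopped, each $\mathbf{A}^{(n)}$ is replaced by the factor $\mathbf{Q}^{(n)}$ of its QR decomposition $\mathbf{A}^{(n)}=\mathbf{Q}^{(n)}\mathbf{R}^{(n)}$,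 and $\mathcal{G}$ by its $n$-mode product with $\mathbf{R}^{(n)}$ for $n=1,\dots,N$, which keeps the reconstruction error the same. *)

theory Defs
  imports
    Complex_Main
    "HOL-Library.FuncSet"
    "Jordan_Normal_Form.Gauss_Jordan_Elimination"
begin

text \<open>
  Modes, index tuples and matrix entries are numbered from 0. A tensor of size
  \<open>D 0 \<times> \<dots> \<times> D (N - 1)\<close> is a real function on \<open>tuples N D\<close>; its values elsewhere are never used.
  The factor matrices form a family \<open>A\<close>, with \<open>A k\<close> of size \<open>I k \<times> J k\<close> for \<open>k < N\<close>.
\<close>

type_synonym tensor = "(nat \<Rightarrow> nat) \<Rightarrow> real"

definition tuples :: "nat \<Rightarrow> (nat \<Rightarrow> nat) \<Rightarrow> (nat \<Rightarrow> nat) set" where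
  "tuples N D = (\<Pi>\<^sub>E k\<in>{..<N}. {..<D k})"

definition factors :: "nat \<Rightarrow> (nat \<Rightarrow> nat) \<Rightarrow> (nat \<Rightarrow> nat) \<Rightarrow> (nat \<Rightarrow> real mat) set" where
  "factors N I J = {A. \<forall>k<N. A k \<in> carrier_mat (I k) (J k)}"

definition frobenius_norm :: "real mat \<Rightarrow> real" where
  "frobenius_norm M = sqrt (\<Sum>i<dim_row M. \<Sum>j<dim_col M. (M $$ (i, j))\<^sup>2)"

definition predict ::
  "nat \<Rightarrow> (nat \<Rightarrow> nat) \<Rightarrow> tensor \<Rightarrow> (nat \<Rightarrow> real mat) \<Rightarrow> (nat \<Rightarrow> nat) \<Rightarrow> real" where
  "predict N J G A \<alpha> = (\<Sum>\<beta>\<in>tuples N J. G \<beta> * (\<Prod>k<N. A k $$ (\<alpha> k, \<beta> k)))"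

definition loss ::
  "nat \<Rightarrow> (nat \<Rightarrow> nat) \<Rightarrow> (nat \<Rightarrow> nat) set \<Rightarrow> tensor \<Rightarrow> real \<Rightarrow> tensor \<Rightarrow> (nat \<Rightarrow> real mat) \<Rightarrow> real" where
  "loss N J \<Omega> X lam G A =
     (\<Sum>\<alpha>\<in>\<Omega>. (X \<alpha> - predict N J G A \<alpha>)\<^sup>2) + lam * (\<Sum>k<N. (frobenius_norm (A k))\<^sup>2)"

definition reconstruction_error ::
  "nat \<Rightarrow> (nat \<Rightarrow> nat) \<Rightarrow> (nat \<Rightarrow> nat) set \<Rightarrow> tensor \<Rightarrow> tensor \<Rightarrow> (nat \<Rightarrow> real mat) \<Rightarrow> real" where
  "reconstruction_error N J \<Omega> X G A = sqrt (\<Sum>\<alpha>\<in>\<Omega>. (X \<alpha> - predict N J G A \<alpha>)\<^sup>2)"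

definition delta ::
  "nat \<Rightarrow> (nat \<Rightarrow> nat) \<Rightarrow> tensor \<Rightarrow> (nat \<Rightarrow> real mat) \<Rightarrow> nat \<Rightarrow> (nat \<Rightarrow> nat) \<Rightarrow> nat \<Rightarrow> real" where
  "delta N J G A n \<alpha> j =
     (\<Sum>\<beta>\<in>{\<beta> \<in> tuples N J. \<beta> n = j}. G \<beta> * (\<Prod>k\<in>{..<N} - {n}. A k $$ (\<alpha> k, \<beta> k)))"

definition slice :: "(nat \<Rightarrow> nat) set \<Rightarrow> nat \<Rightarrow> nat \<Rightarrow> (nat \<Rightarrow> nat) set" where
  "slice \<Omega> n i = {\<alpha> \<in> \<Omega>. \<alpha> n = i}"

definition gram_mat ::
  "nat \<Rightarrow> (nat \<Rightarrow> nat) \<Rightarrow> (nat \<Rightarrow> nat) set \<Rightarrow> tensor \<Rightarrow> (nat \<Rightarrow> real mat) \<Rightarrow> nat \<Rightarrow> nat \<Rightarrow> real mat" where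
  "gram_mat N J \<Omega> G A n i =
     mat (J n) (J n) (\<lambda>(j, j'). \<Sum>\<alpha>\<in>slice \<Omega> n i. delta N J G A n \<alpha> j * delta N J G A n \<alpha> j')"

definition rhs_vec ::
  "nat \<Rightarrow> (nat \<Rightarrow> nat) \<Rightarrow> (nat \<Rightarrow> nat) set \<Rightarrow> tensor \<Rightarrow> tensor \<Rightarrow> (nat \<Rightarrow> real mat) \<Rightarrow> nat \<Rightarrow> nat \<Rightarrow> real vec" where
  "rhs_vec N J \<Omega> X G A n i =
     vec (J n) (\<lambda>j. \<Sum>\<alpha>\<in>slice \<Omega> n i. X \<alpha> * delta N J G A n \<alpha> j)"

text \<open>
  For \<open>lam > 0\<close> the matrix inverted below is symmetric positive definite (a Gram matrix plus a
  positive multiple of the identity), so \<open>mat_inverse\<close> does not return \<open>None\<close>.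
\<close>

definition new_row ::
  "nat \<Rightarrow> (nat \<Rightarrow> nat) \<Rightarrow> (nat \<Rightarrow> nat) set \<Rightarrow> tensor \<Rightarrow> real \<Rightarrow> tensor \<Rightarrow> (nat \<Rightarrow> real mat) \<Rightarrow> nat \<Rightarrow> nat \<Rightarrow> real vec" where
  "new_row N J \<Omega> X lam G A n i =
     row (mat_of_row (rhs_vec N J \<Omega> X G A n i)
          * the (mat_inverse (gram_mat N J \<Omega> G A n i + lam \<cdot>\<^sub>m 1\<^sub>m (J n)))) 0"

definition row_update ::
  "nat \<Rightarrow> (nat \<Rightarrow> nat) \<Rightarrow> (nat \<Rightarrow> nat) set \<Rightarrow> tensor \<Rightarrow> real \<Rightarrow> tensor \<Rightarrow> nat \<times> nat \<Rightarrow>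
   (nat \<Rightarrow> real mat) \<Rightarrow> (nat \<Rightarrow> real mat)" where
  "row_update N J \<Omega> X lam G = (\<lambda>(n, i) A.
     A(n := mat (dim_row (A n)) (dim_col (A n))
              (\<lambda>(r, j). if r = i then new_row N J \<Omega> X lam G A n i $ j else A n $$ (r, j))))"

text \<open>
  The row updates of one iteration, in order: modes in turn and, within a mode, rows in turn.
  Since \<open>delta\<close> for mode \<open>n\<close> does not involve \<open>A n\<close>, updating the rows of one matrix one after
  another gives the same result as updating them all in parallel.
\<close>

definition schedule :: "nat \<Rightarrow> (nat \<Rightarrow> nat) \<Rightarrow> (nat \<times> nat) list" where
  "schedule N I = concat (map (\<lambda>n. map (Pair n) [0..<I n]) [0..<N])"

definition partial_iteration ::
  "nat \<Rightarrow> (nat \<Rightarrow> nat) \<Rightarrow> (nat \<Rightarrow> nat) \<Rightarrow> (nat \<Rightarrow> nat) set \<Rightarrow> tensor \<Rightarrow> real \<Rightarrow> tensor \<Rightarrow> nat \<Rightarrow>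
   (nat \<Rightarrow> real mat) \<Rightarrow> (nat \<Rightarrow> real mat)" where
  "partial_iteration N I J \<Omega> X lam G m =
     fold (row_update N J \<Omega> X lam G) (take m (schedule N I))"

definition iteration ::
  "nat \<Rightarrow> (nat \<Rightarrow> nat) \<Rightarrow> (nat \<Rightarrow> nat) \<Rightarrow> (nat \<Rightarrow> nat) set \<Rightarrow> tensor \<Rightarrow> real \<Rightarrow> tensor \<Rightarrow>
   (nat \<Rightarrow> real mat) \<Rightarrow> (nat \<Rightarrow> real mat)" where
  "iteration N I J \<Omega> X lam G = fold (row_update N J \<Omega> X lam G) (schedule N I)"

text \<open>
  The factor matrices after \<open>t\<close> iterations, without a stopping rule, so that convergence in
  \<open>t\<close> is meaningful. The core tensor stays fixed throughout.
\<close>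

definition ptucker ::
  "nat \<Rightarrow> (nat \<Rightarrow> nat) \<Rightarrow> (nat \<Rightarrow> nat) \<Rightarrow> (nat \<Rightarrow> nat) set \<Rightarrow> tensor \<Rightarrow> real \<Rightarrow> tensor \<Rightarrow>
   (nat \<Rightarrow> real mat) \<Rightarrow> nat \<Rightarrow> (nat \<Rightarrow> real mat)" where
  "ptucker N I J \<Omega> X lam G A0 t = (iteration N I J \<Omega> X lam G ^^ t) A0"

end

theory Submission
  imports Defs "Jordan_Normal_Form.Determinant" "HOL-Analysis.L2_Norm"
begin

text \<open>
  Each row update minimises the loss over that row, a quadratic with Hessian at least
  \<open>2 * lam\<close>. Expanding this quadratic about its minimiser shows that the loss drops by at least the
  squared \<open>\<ell>\<^sup>2\<close> distance between the old and the new predictions on \<open>\<Omega>\<close>. As the reconstruction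
  error is an \<open>\<ell>\<^sup>2\<close> norm, it changes by at most the square root of the drop. The loss being
  decreasing and nonnegative, the drops tend to 0, and with them the changes of the error.
\<close>

section \<open>Finite index sets and ridge regression\<close>

lemma finite_tuples: "finite (tuples N D)"
  unfolding tuples_def by (rule finite_PiE) auto

text \<open>The hypothesis says that the gradient of the ridge objective vanishes at
  \<open>x\<close>. The objective is quadratic, so its expansion about \<open>x\<close> is exact: no
  linear term remains, and the second-order term is the objective of the displacement
  \<open>y - x\<close> with zero data.\<close>

lemma ridge_expansion:
  fixes a :: "'a \<Rightarrow> real" and d :: "'a \<Rightarrow> nat \<Rightarrow> real" and x y :: "nat \<Rightarrow> real"
  assumes normal: "\<And>j. j < m \<Longrightarrow>
    (\<Sum>l<m. x l * (\<Sum>\<alpha>\<in>S. d \<alpha> l * d \<alpha> j)) + lam * x j = (\<Sum>\<alpha>\<in>S. a \<alpha> * d \<alpha> j)"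
  shows "(\<Sum>\<alpha>\<in>S. (a \<alpha> - (\<Sum>j<m. y j * d \<alpha> j))\<^sup>2) + lam * (\<Sum>j<m. (y j)\<^sup>2)
    = (\<Sum>\<alpha>\<in>S. (a \<alpha> - (\<Sum>j<m. x j * d \<alpha> j))\<^sup>2) + lam * (\<Sum>j<m. (x j)\<^sup>2)
      + (\<Sum>\<alpha>\<in>S. ((\<Sum>j<m. y j * d \<alpha> j) - (\<Sum>j<m. x j * d \<alpha> j))\<^sup>2)
      + lam * (\<Sum>j<m. (y j - x j)\<^sup>2)"
proof -
  define p where "p z \<alpha> = (\<Sum>j<m. z j * d \<alpha> j)" for z \<alpha>
  define h where "h j = y j - x j" for j
  have py: "p y \<alpha> = p x \<alpha> + p h \<alpha>" for \<alpha>
    by (simp add: p_def h_def sum.distrib[symmetric] algebra_simps)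
  \<comment> \<open>By the normal equation, the cross term that the fit contributes equals the one
    that the penalty contributes. They enter with opposite signs and cancel at the end.\<close>
  have orth: "(\<Sum>\<alpha>\<in>S. (a \<alpha> - p x \<alpha>) * p h \<alpha>) = lam * (\<Sum>j<m. x j * h j)"
  proof -
    have n: "(\<Sum>\<alpha>\<in>S. (a \<alpha> - p x \<alpha>) * d \<alpha> j) = lam * x j" if "j < m" for j
    proof -
      have "(\<Sum>\<alpha>\<in>S. p x \<alpha> * d \<alpha> j) = (\<Sum>l<m. x l * (\<Sum>\<alpha>\<in>S. d \<alpha> l * d \<alpha> j))"
        unfolding p_def sum_distrib_left sum_distrib_right
        by (subst sum.swap) (simp add: mult.assoc)
      then show ?thesis
        using normal[OF that] by (simp add: left_diff_distrib sum_subtractf)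
    qed
    have "(\<Sum>\<alpha>\<in>S. (a \<alpha> - p x \<alpha>) * p h \<alpha>) = (\<Sum>j<m. h j * (\<Sum>\<alpha>\<in>S. (a \<alpha> - p x \<alpha>) * d \<alpha> j))"
      unfolding p_def[of h] sum_distrib_left
      by (subst sum.swap) (simp add: mult_ac)
    also have "\<dots> = (\<Sum>j<m. h j * (lam * x j))"
      by (intro sum.cong) (auto simp: n)
    finally show ?thesis by (simp add: sum_distrib_left mult_ac)
  qed
  have "(\<Sum>\<alpha>\<in>S. (a \<alpha> - p y \<alpha>)\<^sup>2)
      = (\<Sum>\<alpha>\<in>S. (a \<alpha> - p x \<alpha>)\<^sup>2 + (p y \<alpha> - p x \<alpha>)\<^sup>2 - 2 * ((a \<alpha> - p x \<alpha>) * p h \<alpha>))"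
    by (intro sum.cong refl) (simp add: py power2_eq_square algebra_simps)
  also have "\<dots> = (\<Sum>\<alpha>\<in>S. (a \<alpha> - p x \<alpha>)\<^sup>2) + (\<Sum>\<alpha>\<in>S. (p y \<alpha> - p x \<alpha>)\<^sup>2)
      - 2 * (lam * (\<Sum>j<m. x j * h j))"
    by (simp only: sum.distrib sum_subtractf sum_distrib_left[symmetric] orth)
  finally have 1: "(\<Sum>\<alpha>\<in>S. (a \<alpha> - p y \<alpha>)\<^sup>2) = \<dots>" .
  have "(\<Sum>j<m. (y j)\<^sup>2) = (\<Sum>j<m. (x j)\<^sup>2 + (y j - x j)\<^sup>2 + 2 * (x j * h j))"
    by (intro sum.cong refl) (simp add: h_def power2_eq_square algebra_simps)
  also have "\<dots> = (\<Sum>j<m. (x j)\<^sup>2) + (\<Sum>j<m. (y j - x j)\<^sup>2) + 2 * (\<Sum>j<m. x j * h j)"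
    by (simp only: sum.distrib sum_distrib_left[symmetric])
  finally have 2: "(\<Sum>j<m. (y j)\<^sup>2) = \<dots>" .
  show ?thesis
    unfolding p_def[symmetric] 1 2 by (simp add: algebra_simps)
qed

text \<open>Injectivity suffices, since a square matrix with trivial kernel has nonzero determinant.
  The conclusion is stated with \<open>Units\<close> because this is what excludes the value
  \<open>None\<close> of \<open>mat_inverse\<close>.\<close>

lemma gram_plus_ridge_unit:
  fixes d :: "'a \<Rightarrow> nat \<Rightarrow> real"
  assumes "lam > 0"
  shows "mat m m (\<lambda>(j, j'). \<Sum>\<alpha>\<in>S. d \<alpha> j * d \<alpha> j') + lam \<cdot>\<^sub>m 1\<^sub>m m \<in> Units (ring_mat TYPE(real) m b)"
    (is "?M \<in> _")
proof -
  have M: "?M \<in> carrier_mat m m" by simp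
  have "v = 0\<^sub>v m" if v: "v \<in> carrier_vec m" and 0: "?M *\<^sub>v v = 0\<^sub>v m" for v
  proof -
    have row: "(\<Sum>l<m. v $ l * (\<Sum>\<alpha>\<in>S. d \<alpha> l * d \<alpha> j)) + lam * v $ j = 0" if j: "j < m" for j
    proof -
      have "0 = (?M *\<^sub>v v) $ j" using j by (simp add: 0)
      also have "\<dots> = (\<Sum>l<m. ((\<Sum>\<alpha>\<in>S. d \<alpha> j * d \<alpha> l) + lam * (if j = l then 1 else 0)) * v $ l)"
        using j v by (auto simp: scalar_prod_def atLeast0LessThan intro!: sum.cong)
      also have "\<dots> = (\<Sum>l<m. v $ l * (\<Sum>\<alpha>\<in>S. d \<alpha> l * d \<alpha> j) + (if j = l then lam * v $ l else 0))"
        by (intro sum.cong refl) (simp add: algebra_simps)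
      also have "\<dots> = (\<Sum>l<m. v $ l * (\<Sum>\<alpha>\<in>S. d \<alpha> l * d \<alpha> j)) + lam * v $ j"
        using j by (simp add: sum.distrib)
      finally show ?thesis by simp
    qed
    \<comment> \<open>A kernel vector \<open>v\<close> solves the normal equation with data 0.
      Expanding about \<open>v\<close> and evaluating at \<open>y = 0\<close> gives 0 as twice the
      objective at \<open>v\<close>; both terms of that objective are nonnegative and
      \<open>lam > 0\<close>, so \<open>v\<close> vanishes.\<close>
    have "0 = (\<Sum>\<alpha>\<in>S. (\<Sum>j<m. v $ j * d \<alpha> j)\<^sup>2) + lam * (\<Sum>j<m. (v $ j)\<^sup>2)
        + ((\<Sum>\<alpha>\<in>S. (\<Sum>j<m. v $ j * d \<alpha> j)\<^sup>2) + lam * (\<Sum>j<m. (v $ j)\<^sup>2))"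
      using ridge_expansion[of m "\<lambda>j. v $ j" d S lam "\<lambda>_. 0" "\<lambda>_. 0"] row by simp
    moreover have "0 \<le> (\<Sum>\<alpha>\<in>S. (\<Sum>j<m. v $ j * d \<alpha> j)\<^sup>2)" "0 \<le> (\<Sum>j<m. (v $ j)\<^sup>2)"
      by (auto intro: sum_nonneg)
    ultimately have "(\<Sum>j<m. (v $ j)\<^sup>2) = 0"
      using assms by (smt (verit) mult_pos_pos)
    then show ?thesis
      using v by (auto simp: sum_nonneg_eq_0_iff)
  qed
  then have "det ?M \<noteq> 0"
    using det_0_iff_vec_prod_zero_field[OF M] by blast
  then show ?thesis by (rule det_non_zero_imp_unit[OF M])
qed

text \<open>This supplies the hypothesis of \<open>ridge_expansion\<close> for the computed row:
  multiplying the row \<open>c * K\<close> on the right by \<open>M\<close> gives back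
  \<open>c\<close>, and the claim is entry \<open>j\<close> of this identity.\<close>

lemma new_row_normal_equation:
  assumes "lam > 0" "j < J n"
  shows "(\<Sum>l<J n. new_row N J \<Omega> X lam G A n i $ l *
      (\<Sum>\<alpha>\<in>slice \<Omega> n i. delta N J G A n \<alpha> l * delta N J G A n \<alpha> j))
      + lam * new_row N J \<Omega> X lam G A n i $ j
    = (\<Sum>\<alpha>\<in>slice \<Omega> n i. X \<alpha> * delta N J G A n \<alpha> j)"
proof -
  define M where "M = gram_mat N J \<Omega> G A n i + lam \<cdot>\<^sub>m 1\<^sub>m (J n)"
  define c where "c = mat_of_row (rhs_vec N J \<Omega> X G A n i)"
  have M: "M \<in> carrier_mat (J n) (J n)" by (simp add: M_def gram_mat_def)
  have c: "c \<in> carrier_mat 1 (J n)"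
    by (simp add: c_def rhs_vec_def mat_of_row_def)
  \<comment> \<open>Invertibility makes \<open>the (mat_inverse M)\<close> a genuine two-sided
    inverse rather than an unspecified value.\<close>
  have "M \<in> Units (ring_mat TYPE(real) (J n) b)" for b
    unfolding M_def gram_mat_def by (rule gram_plus_ridge_unit[OF assms(1)])
  then obtain K where K: "mat_inverse M = Some K"
    using mat_inverse(1)[OF M] by fastforce
  note inv = mat_inverse(2)[OF M K]
  define x where "x = new_row N J \<Omega> X lam G A n i"
  have x: "x = row (c * K) 0" by (simp add: x_def new_row_def c_def M_def[symmetric] K)
  have "c * K * M = c * (K * M)" using c M inv by (intro assoc_mult_mat) auto
  also have "\<dots> = c" using c inv by simp
  finally have cKM: "c * K * M = c" .
  have "(\<Sum>\<alpha>\<in>slice \<Omega> n i. X \<alpha> * delta N J G A n \<alpha> j) = (c * K * M) $$ (0, j)"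
    unfolding cKM using assms by (simp add: c_def mat_of_row_def rhs_vec_def)
  also have "\<dots> = x \<bullet> col M j"
    using c M inv assms by (simp add: x)
  also have "\<dots> = (\<Sum>l<J n. x $ l * ((\<Sum>\<alpha>\<in>slice \<Omega> n i. delta N J G A n \<alpha> l * delta N J G A n \<alpha> j)
      + lam * (if l = j then 1 else 0)))"
    using assms M by (simp add: scalar_prod_def atLeast0LessThan M_def gram_mat_def)
  also have "\<dots> = (\<Sum>l<J n. x $ l * (\<Sum>\<alpha>\<in>slice \<Omega> n i. delta N J G A n \<alpha> l * delta N J G A n \<alpha> j)
      + (if l = j then lam * x $ l else 0))"
    by (intro sum.cong refl) (simp add: algebra_simps)
  also have "\<dots> = (\<Sum>l<J n. x $ l * (\<Sum>\<alpha>\<in>slice \<Omega> n i. delta N J G A n \<alpha> l * delta N J G A n \<alpha> j))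
      + lam * x $ j"
    using assms by (simp add: sum.distrib)
  finally show ?thesis by (simp add: x_def)
qed

section \<open>Predictions and loss under one row update\<close>

lemma predict_eq_delta:
  assumes "n < N"
  shows "predict N J G A \<alpha> = (\<Sum>j<J n. A n $$ (\<alpha> n, j) * delta N J G A n \<alpha> j)"
proof -
  have "predict N J G A \<alpha> = (\<Sum>\<beta>\<in>tuples N J. A n $$ (\<alpha> n, \<beta> n) *
      (G \<beta> * (\<Prod>k\<in>{..<N} - {n}. A k $$ (\<alpha> k, \<beta> k))))"
    unfolding predict_def
    using assms by (intro sum.cong refl) (simp add: prod.remove[of "{..<N}" n])
  \<comment> \<open>Grouping the core indices by their \<open>n\<close>-th coordinate makes the
    prediction linear in row \<open>\<alpha> n\<close> of \<open>A n\<close>. The coefficients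
    involve only the other factor matrices, so choosing one row is a ridge regression.\<close>
  also have "\<dots> = (\<Sum>j<J n. \<Sum>\<beta>\<in>{\<beta> \<in> tuples N J. \<beta> n = j}. A n $$ (\<alpha> n, \<beta> n) *
      (G \<beta> * (\<Prod>k\<in>{..<N} - {n}. A k $$ (\<alpha> k, \<beta> k))))"
    using assms by (intro sum.group[symmetric] finite_tuples) (auto simp: tuples_def PiE_def Pi_def)
  also have "\<dots> = (\<Sum>j<J n. A n $$ (\<alpha> n, j) * delta N J G A n \<alpha> j)"
    unfolding delta_def sum_distrib_left by (intro sum.cong refl) auto
  finally show ?thesis .
qed

lemma delta_cong:
  assumes "\<And>k. k \<noteq> n \<Longrightarrow> A k = B k"
  shows "delta N J G A n = delta N J G B n"
  unfolding delta_def using assms by (intro ext sum.cong refl arg_cong2[of _ _ _ _ "(*)"] prod.cong) auto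

lemma row_update_factors:
  assumes "A \<in> factors N I J"
  shows "row_update N J \<Omega> X lam G p A \<in> factors N I J"
  using assms by (auto simp: row_update_def factors_def split: prod.split)

lemma frobenius_norm_square:
  "M \<in> carrier_mat p q \<Longrightarrow> (frobenius_norm M)\<^sup>2 = (\<Sum>i<p. \<Sum>j<q. (M $$ (i, j))\<^sup>2)"
  by (auto simp: frobenius_norm_def sum_nonneg)

text \<open>With everything but row \<open>i\<close> of \<open>A n\<close> fixed, the loss is the
  ridge objective of that row on the slice, plus terms that do not depend on the row. The new row
  satisfies the normal equation, so \<open>ridge_expansion\<close> gives the excess loss of the old
  row exactly.\<close>

lemma loss_row_update:
  fixes X G :: tensor
  assumes \<Omega>: "\<Omega> \<subseteq> tuples N I" and lam: "lam > 0" and A: "A \<in> factors N I J"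
    and n: "n < N" and i: "i < I n"
  defines "A' \<equiv> row_update N J \<Omega> X lam G (n, i) A"
  shows "loss N J \<Omega> X lam G A' + (\<Sum>\<alpha>\<in>\<Omega>. (predict N J G A \<alpha> - predict N J G A' \<alpha>)\<^sup>2)
    \<le> loss N J \<Omega> X lam G A"
proof -
  define S where "S = slice \<Omega> n i"
  define d where "d = delta N J G A n"
  define x where "x j = new_row N J \<Omega> X lam G A n i $ j" for j
  define y where "y j = A n $$ (i, j)" for j
  let ?p = "predict N J G A" and ?p' = "predict N J G A'"
  have fin: "finite \<Omega>" using \<Omega> finite_tuples finite_subset by blast
  have An: "A n \<in> carrier_mat (I n) (J n)" using A n by (auto simp: factors_def)
  have An': "A' n \<in> carrier_mat (I n) (J n)"
    using row_update_factors[OF A] n by (auto simp: factors_def A'_def)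
  have other: "A' k = A k" if "k \<noteq> n" for k using that by (simp add: A'_def row_update_def)
  have entry: "A' n $$ (r, j) = (if r = i then x j else A n $$ (r, j))" if "r < I n" "j < J n" for r j
    using that An by (auto simp: A'_def row_update_def x_def)
  \<comment> \<open>Only the matrix of mode \<open>n\<close> changes, so the old and new predictions
    are linear forms with the same coefficients \<open>d\<close>.\<close>
  have d': "delta N J G A' n = d" unfolding d_def by (rule delta_cong) (rule other)
  have pS: "?p \<alpha> = (\<Sum>j<J n. y j * d \<alpha> j)" "?p' \<alpha> = (\<Sum>j<J n. x j * d \<alpha> j)" if "\<alpha> \<in> S" for \<alpha>
    using that i by (auto simp: predict_eq_delta[OF n] d' d_def[symmetric] S_def slice_def y_def entry)
  \<comment> \<open>Outside the slice a prediction reads a row other than \<open>i\<close>. That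
    \<open>\<Omega>\<close> consists of index tuples keeps this row inside the matrix, where
    \<open>entry\<close> applies.\<close>
  have pR: "?p' \<alpha> = ?p \<alpha>" if "\<alpha> \<in> \<Omega> - S" for \<alpha>
  proof -
    have "\<alpha> n < I n" "\<alpha> n \<noteq> i"
      using that \<Omega> n by (auto simp: S_def slice_def tuples_def PiE_def Pi_def)
    then show ?thesis
      by (auto simp: predict_eq_delta[OF n] d' d_def[symmetric] entry)
  qed
  have split: "sum f \<Omega> = sum f (\<Omega> - S) + sum f S" for f :: "_ \<Rightarrow> real"
    using fin by (intro sum.subset_diff) (auto simp: S_def slice_def)
  have fA: "(\<Sum>k<N. (frobenius_norm (B k))\<^sup>2)
      = (\<Sum>j<J n. (B n $$ (i, j))\<^sup>2) + ((\<Sum>r\<in>{..<I n} - {i}. \<Sum>j<J n. (B n $$ (r, j))\<^sup>2)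
        + (\<Sum>k\<in>{..<N} - {n}. (frobenius_norm (B k))\<^sup>2))" if "B n \<in> carrier_mat (I n) (J n)" for B
    using n i by (simp add: sum.remove[of "{..<N}" n] frobenius_norm_square[OF that]
        sum.remove[of "{..<I n}" i])
  \<comment> \<open>The part of the penalty that row \<open>i\<close> of mode \<open>n\<close> does
    not enter; it is common to \<open>A\<close> and \<open>A'\<close>.\<close>
  define R where "R = (\<Sum>r\<in>{..<I n} - {i}. \<Sum>j<J n. (A n $$ (r, j))\<^sup>2)
    + (\<Sum>k\<in>{..<N} - {n}. (frobenius_norm (A k))\<^sup>2)"
  have fro: "(\<Sum>k<N. (frobenius_norm (A k))\<^sup>2) = (\<Sum>j<J n. (y j)\<^sup>2) + R"
    by (simp add: fA[of A, OF An] R_def y_def)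
  have fro': "(\<Sum>k<N. (frobenius_norm (A' k))\<^sup>2) = (\<Sum>j<J n. (x j)\<^sup>2) + R"
    unfolding fA[of A', OF An'] R_def using i by (simp add: other entry)
  have "(\<Sum>\<alpha>\<in>S. (X \<alpha> - (\<Sum>j<J n. y j * d \<alpha> j))\<^sup>2) + lam * (\<Sum>j<J n. (y j)\<^sup>2)
    = (\<Sum>\<alpha>\<in>S. (X \<alpha> - (\<Sum>j<J n. x j * d \<alpha> j))\<^sup>2) + lam * (\<Sum>j<J n. (x j)\<^sup>2)
      + (\<Sum>\<alpha>\<in>S. ((\<Sum>j<J n. y j * d \<alpha> j) - (\<Sum>j<J n. x j * d \<alpha> j))\<^sup>2)
      + lam * (\<Sum>j<J n. (y j - x j)\<^sup>2)"
    unfolding x_def S_def d_def by (intro ridge_expansion new_row_normal_equation lam)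
  \<comment> \<open>The displacement of the row itself is discarded: only the change of the
    predictions is needed to control the reconstruction error.\<close>
  moreover have "0 \<le> lam * (\<Sum>j<J n. (y j - x j)\<^sup>2)"
    using lam by (simp add: sum_nonneg)
  ultimately have "(\<Sum>\<alpha>\<in>S. (X \<alpha> - ?p' \<alpha>)\<^sup>2) + lam * (\<Sum>j<J n. (x j)\<^sup>2) + (\<Sum>\<alpha>\<in>S. (?p \<alpha> - ?p' \<alpha>)\<^sup>2)
      \<le> (\<Sum>\<alpha>\<in>S. (X \<alpha> - ?p \<alpha>)\<^sup>2) + lam * (\<Sum>j<J n. (y j)\<^sup>2)"
    by (simp add: pS)
  then show ?thesis
    by (simp add: loss_def fro fro' split pR algebra_simps)
qed

section \<open>Control of the reconstruction error by the loss\<close>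

lemma reconstruction_error_L2_set:
  "reconstruction_error N J \<Omega> X G A = L2_set (\<lambda>\<alpha>. X \<alpha> - predict N J G A \<alpha>) \<Omega>"
  by (simp add: reconstruction_error_def L2_set_def)

text \<open>The residuals of \<open>A\<close> and \<open>B\<close> differ by the difference of their
  predictions, so this is the reverse triangle inequality, obtained from the triangle inequality
  used in both directions.\<close>

lemma reconstruction_error_lipschitz:
  "\<bar>reconstruction_error N J \<Omega> X G B - reconstruction_error N J \<Omega> X G A\<bar>
    \<le> L2_set (\<lambda>\<alpha>. predict N J G A \<alpha> - predict N J G B \<alpha>) \<Omega>"
proof -
  have le: "reconstruction_error N J \<Omega> X G B \<le> reconstruction_error N J \<Omega> X G A
      + L2_set (\<lambda>\<alpha>. predict N J G A \<alpha> - predict N J G B \<alpha>) \<Omega>" for A B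
    using L2_set_triangle_ineq[of "\<lambda>\<alpha>. X \<alpha> - predict N J G A \<alpha>"
        "\<lambda>\<alpha>. predict N J G A \<alpha> - predict N J G B \<alpha>" \<Omega>]
    by (simp add: reconstruction_error_L2_set)
  have "L2_set (\<lambda>\<alpha>. predict N J G B \<alpha> - predict N J G A \<alpha>) \<Omega>
      = L2_set (\<lambda>\<alpha>. predict N J G A \<alpha> - predict N J G B \<alpha>) \<Omega>"
    by (simp add: L2_set_def power2_commute)
  then show ?thesis using le[of B A] le[of A B] by linarith
qed

text \<open>The second bound expresses the change of the error through loss values alone. In this
  form it can be accumulated over many updates and passed to the limit.\<close>

lemma row_update_decrease:
  fixes X G :: tensor
  assumes "\<Omega> \<subseteq> tuples N I" "lam > 0" "A \<in> factors N I J" "n < N" "i < I n"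
  defines "A' \<equiv> row_update N J \<Omega> X lam G (n, i) A"
  shows "loss N J \<Omega> X lam G A' \<le> loss N J \<Omega> X lam G A"
    and "\<bar>reconstruction_error N J \<Omega> X G A' - reconstruction_error N J \<Omega> X G A\<bar>
      \<le> sqrt (loss N J \<Omega> X lam G A - loss N J \<Omega> X lam G A')"
proof -
  have drop: "loss N J \<Omega> X lam G A' + (\<Sum>\<alpha>\<in>\<Omega>. (predict N J G A \<alpha> - predict N J G A' \<alpha>)\<^sup>2)
      \<le> loss N J \<Omega> X lam G A"
    unfolding A'_def by (rule loss_row_update[OF assms(1-5)])
  have "0 \<le> (\<Sum>\<alpha>\<in>\<Omega>. (predict N J G A \<alpha> - predict N J G A' \<alpha>)\<^sup>2)" by (simp add: sum_nonneg)
  then show "loss N J \<Omega> X lam G A' \<le> loss N J \<Omega> X lam G A" using drop by linarith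
  have "L2_set (\<lambda>\<alpha>. predict N J G A \<alpha> - predict N J G A' \<alpha>) \<Omega>
      \<le> sqrt (loss N J \<Omega> X lam G A - loss N J \<Omega> X lam G A')"
    unfolding L2_set_def using drop by (intro real_sqrt_le_mono) linarith
  then show "\<bar>reconstruction_error N J \<Omega> X G A' - reconstruction_error N J \<Omega> X G A\<bar>
      \<le> sqrt (loss N J \<Omega> X lam G A - loss N J \<Omega> X lam G A')"
    using reconstruction_error_lipschitz order_trans by blast
qed

section \<open>Sequences of row updates and convergence\<close>

lemma fold_row_update_factors:
  "A \<in> factors N I J \<Longrightarrow> fold (row_update N J \<Omega> X lam G) ps A \<in> factors N I J"
  by (induction ps arbitrary: A) (simp_all add: row_update_factors)

text \<open>Each update changes the error by at most the root of its own drop, and by monotonicity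
  no single drop exceeds the total one. This gives one root of the total drop per update, hence the
  factor \<open>length ps\<close>. The two claims are proved together because the error bound uses
  the monotonicity of the remaining updates.\<close>

lemma fold_row_update_decrease:
  fixes X G :: tensor
  assumes "\<Omega> \<subseteq> tuples N I" "lam > 0" "A \<in> factors N I J"
    and "\<And>n i. (n, i) \<in> set ps \<Longrightarrow> n < N \<and> i < I n"
  defines "A' \<equiv> fold (row_update N J \<Omega> X lam G) ps A"
  shows "loss N J \<Omega> X lam G A' \<le> loss N J \<Omega> X lam G A \<and>
    \<bar>reconstruction_error N J \<Omega> X G A' - reconstruction_error N J \<Omega> X G A\<bar>
      \<le> length ps * sqrt (loss N J \<Omega> X lam G A - loss N J \<Omega> X lam G A')"
  using assms(3,4) unfolding A'_def
proof (induction ps arbitrary: A)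
  case Nil
  then show ?case by simp
next
  case (Cons p ps)
  obtain n i where p: "p = (n, i)" by fastforce
  let ?L = "loss N J \<Omega> X lam G" and ?e = "reconstruction_error N J \<Omega> X G"
  define B where "B = row_update N J \<Omega> X lam G p A"
  define C where "C = fold (row_update N J \<Omega> X lam G) ps B"
  have ni: "n < N" "i < I n" using Cons.prems(2)[of n i] p by auto
  have B: "?L B \<le> ?L A" "\<bar>?e B - ?e A\<bar> \<le> sqrt (?L A - ?L B)"
    unfolding B_def p
    using row_update_decrease[where X = X and G = G, OF assms(1,2) Cons.prems(1) ni] by auto
  have "B \<in> factors N I J" unfolding B_def by (rule row_update_factors[OF Cons.prems(1)])
  then have C: "?L C \<le> ?L B" "\<bar>?e C - ?e B\<bar> \<le> length ps * sqrt (?L B - ?L C)"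
    unfolding C_def using Cons.IH[of B] Cons.prems(2) by auto
  have s1: "sqrt (?L A - ?L B) \<le> sqrt (?L A - ?L C)"
    using C(1) by (intro real_sqrt_le_mono) simp
  have s2: "length ps * sqrt (?L B - ?L C) \<le> length ps * sqrt (?L A - ?L C)"
    using B(1) by (intro mult_left_mono real_sqrt_le_mono) simp_all
  have "\<bar>?e C - ?e A\<bar> \<le> (1 + real (length ps)) * sqrt (?L A - ?L C)"
    unfolding distrib_right using B(2) C(2) s1 s2 by linarith
  then show ?case using B(1) C(1) by (simp add: B_def C_def)
qed

lemma set_schedule: "(n, i) \<in> set (schedule N I) \<longleftrightarrow> n < N \<and> i < I n"
  by (force simp: schedule_def)

lemma loss_nonneg: "0 \<le> lam \<Longrightarrow> 0 \<le> loss N J \<Omega> X lam G A"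
  by (simp add: loss_def sum_nonneg)

theorem theorem2:
  fixes N :: nat and I J :: "nat \<Rightarrow> nat" and \<Omega> :: "(nat \<Rightarrow> nat) set"
    and X G :: tensor and lam :: real and A0 :: "nat \<Rightarrow> real mat"
  assumes "\<Omega> \<subseteq> tuples N I"
    and "lam > 0"
    and "\<And>\<beta>. \<beta> \<in> tuples N J \<Longrightarrow> G \<beta> \<in> {0..1}"
    and "A0 \<in> factors N I J"
    and "\<And>k i j. k < N \<Longrightarrow> i < I k \<Longrightarrow> j < J k \<Longrightarrow> A0 k $$ (i, j) \<in> {0..1}"
  defines "A \<equiv> ptucker N I J \<Omega> X lam G A0"
    and "L \<equiv> loss N J \<Omega> X lam G"
    and "err \<equiv> reconstruction_error N J \<Omega> X G"
  shows "(\<forall>G' B. 0 \<le> loss N J \<Omega> X lam G' B) \<and>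
    Bseq (\<lambda>t. L (A t)) \<and>
    (\<forall>t. \<forall>m < length (schedule N I).
       L (partial_iteration N I J \<Omega> X lam G (Suc m) (A t))
         \<le> L (partial_iteration N I J \<Omega> X lam G m (A t))) \<and>
    decseq (\<lambda>t. L (A t)) \<and>
    convergent (\<lambda>t. L (A t)) \<and>
    (\<lambda>t. err (A (Suc t)) - err (A t)) \<longlonglongrightarrow> 0"
proof (intro conjI allI impI)
  note [simp] = A_def ptucker_def
  have fac: "A t \<in> factors N I J" for t
    by (induction t) (simp_all add: assms(4) iteration_def fold_row_update_factors)
  \<comment> \<open>The factor \<open>length (schedule N I)\<close> is the same for every
    \<open>t\<close>, so vanishing drops force vanishing changes of the error.\<close>
  have step: "L (A (Suc t)) \<le> L (A t)" "\<bar>err (A (Suc t)) - err (A t)\<bar>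
      \<le> length (schedule N I) * sqrt (L (A t) - L (A (Suc t)))" for t
    using fold_row_update_decrease[where X = X and G = G and ps = "schedule N I",
        OF assms(1,2) fac[of t]]
    by (simp_all add: set_schedule iteration_def L_def err_def)
  show nonneg: "0 \<le> loss N J \<Omega> X lam G' B" for G' B
    using assms(2) by (simp add: loss_nonneg)
  show dec: "decseq (\<lambda>t. L (A t))" by (rule decseq_SucI) (rule step(1))
  have "bdd_below (range (\<lambda>t. L (A t)))"
    by (rule bdd_belowI[of _ 0]) (auto simp: L_def nonneg)
  then obtain l where l: "(\<lambda>t. L (A t)) \<longlonglongrightarrow> l" using LIMSEQ_decseq_INF[OF _ dec] by blast
  then show conv: "convergent (\<lambda>t. L (A t))" by (rule convergentI)
  then show "Bseq (\<lambda>t. L (A t))" by (rule convergent_imp_Bseq)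
  show "L (partial_iteration N I J \<Omega> X lam G (Suc m) (A t))
      \<le> L (partial_iteration N I J \<Omega> X lam G m (A t))" if m: "m < length (schedule N I)" for t m
  proof -
    \<comment> \<open>Passing from \<open>take m\<close> to \<open>take (Suc m)\<close> appends
      exactly the pair at position \<open>m\<close>, so the two partial iterations differ by a
      single row update.\<close>
    obtain n i where ni: "schedule N I ! m = (n, i)" by fastforce
    then have "n < N" "i < I n" using nth_mem[OF m] set_schedule by auto
    moreover have "partial_iteration N I J \<Omega> X lam G m (A t) \<in> factors N I J"
      unfolding partial_iteration_def by (rule fold_row_update_factors[OF fac])
    ultimately show ?thesis
      using row_update_decrease(1)[OF assms(1,2)] m
      by (simp add: L_def partial_iteration_def take_Suc_conv_app_nth ni del: A_def)
  qed
  \<comment> \<open>Consecutive losses share the limit \<open>l\<close>, so the bound in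
    \<open>step\<close> tends to 0. The drops are summable but their roots need not be, so this
    argument yields vanishing consecutive changes and not convergence of the errors
    themselves.\<close>
  have "(\<lambda>t. length (schedule N I) * sqrt (L (A t) - L (A (Suc t)))) \<longlonglongrightarrow>
      length (schedule N I) * sqrt (l - l)"
    by (intro tendsto_intros l LIMSEQ_Suc)
  then have "(\<lambda>t. length (schedule N I) * sqrt (L (A t) - L (A (Suc t)))) \<longlonglongrightarrow> 0" by simp
  then have "(\<lambda>t. \<bar>err (A (Suc t)) - err (A t)\<bar>) \<longlonglongrightarrow> 0"
    by (rule tendsto_sandwich[rotated 3]) (auto simp: step(2) simp del: A_def)
  then show "(\<lambda>t. err (A (Suc t)) - err (A t)) \<longlonglongrightarrow> 0"
    by (rule tendsto_rabs_zero_cancel)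
qed

end
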